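(* For every integer $k\ge 3$ there exists a map $\chi\colon\mathbb{Z}_2^k\to\mathbb{Z}_2$ such that $\mu_{\mathbf 1}\partial\chi\in Z^2(\mathbb{Z}_2^k,\langle -1\rangle)$ is a symmetric orthogonal cocycle, $\chi$ is a $\mathrm{GPBA}(2^k)$ of type $\mathbf 1$, and the expansion $\chi'\colon\mathbb{Z}_4^k\to\mathbb{Z}_2$ of $\chi$ of type $\mathbf 1$ is a generalized partially bent function (GPBF).
   Context: $\mathbb{Z}_t=\{0,1,\ldots,t-1\}$ with addition modulo $t$. For $\chi\colon\mathbb{Z}_2^k\to\mathbb{Z}_2$, the expansion of $\chi$ of type $\mathbf 1$ (the all-ones vector) is $\chi'\colon\mathbb{Z}_4^k\to\mathbb{Z}_2$, $\chi'(g_1,\ldots,g_k)=\chi(g_1\bmod 2,\ldots,g_k\bmod 2)+\sum_i\lfloor g_i/2\rfloor\bmod 2$. For a map $f\colon A\to\mathbb{Z}_2$ on a finite abelian group $A$, $AC_f(w)=\sum_{g\in A}(-1)^{f(g)-f(g+w)}$. With $L=\{0,2\}^k\subset\mathbb{Z}_4^k$, $\chi$ is a $\mathrm{GPBA}(2^k)$ (generalized perfect binary array) of type $\mathbf 1$ if $AC_{\chi'}(g)=0$ for all $g\in\mathbb{Z}_4^k\setminus L$. A map $f\colon\mathbb{Z}_4^k\to\mathbb{Z}_2$ is a generalized partially bent function (GPBF) if $|AC_f(x)|\in\{0,4^k\}$ for all $x\in\mathbb{Z}_4^k$. $Z^2(G,\langle -1\rangle)$ is the group of normalized cocycles $\psi\colon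 G\times G\to\{\pm1\}$, i.e. $\psi(a,b)\psi(a+b,c)=\psi(a,b+c)\psi(b,c)$ and $\psi(0,0)=1$ (arrays $\chi$ are taken with $\chi(\mathbf 0)=0$ when forming $\partial\chi$). Here $\partial\chi(x,y)=(-1)^{\chi(x+y)-\chi(x)-\chi(y)}$ and $\mu_{\mathbf 1}(x,y)=\prod_{i=1}^k(-1)^{\lfloor(x_i+y_i)/2\rfloor}$ with $x_i+y_i$ the integer sum. A cocycle $\psi\in Z^2(G,\langle-1\rangle)$ is orthogonal if the matrix $M_\psi=[\psi(a,b)]_{a,b\in G}$ is a Hadamard matrix ($M_\psi M_\psi^\top=|G|I$), and symmetric if $M_\psi$ is symmetric. *)

theory Defs
  imports Complex_Main "HOL-Algebra.Product_Groups"
begin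

text \<open>
  \<open>Zpow t k\<close> is the group of \<open>k\<close>-tuples over \<open>{0, ..., t - 1}\<close> with componentwise addition
  modulo \<open>t\<close>. A tuple is a function \<open>nat \<Rightarrow> int\<close> that is \<open>undefined\<close> outside \<open>{..<k}\<close>;
  coordinates are numbered from \<open>0\<close>. The library writes the group operation multiplicatively,
  so the sum of tuples is \<open>\<otimes>\<close> and the zero tuple is \<open>\<one>\<close>.
\<close>

abbreviation Zmod :: "nat \<Rightarrow> int monoid" where
  "Zmod t \<equiv> integer_mod_group t"

abbreviation Zpow :: "nat \<Rightarrow> nat \<Rightarrow> (nat \<Rightarrow> int) monoid" where
  "Zpow t k \<equiv> product_group {..<k} (\<lambda>_. Zmod t)"

definition expansion :: "nat \<Rightarrow> ((nat \<Rightarrow> int) \<Rightarrow> int) \<Rightarrow> (nat \<Rightarrow> int) \<Rightarrow> int" where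
  "expansion k \<chi> g = (\<chi> (\<lambda>i\<in>{..<k}. g i mod 2) + (\<Sum>i<k. g i div 2)) mod 2"

text \<open>
  Values in \<open>\<int>\<^sub>2\<close> are represented by the integers \<open>0\<close> and \<open>1\<close>. The exponents below are
  formed in the integers, whence \<open>powi\<close>; only their parity matters.
\<close>

definition AC :: "('a, 'b) monoid_scheme \<Rightarrow> ('a \<Rightarrow> int) \<Rightarrow> 'a \<Rightarrow> real" where
  "AC A f w = (\<Sum>g\<in>carrier A. (-1) powi (f g - f (g \<otimes>\<^bsub>A\<^esub> w)))"

definition GPBA :: "nat \<Rightarrow> ((nat \<Rightarrow> int) \<Rightarrow> int) \<Rightarrow> bool" where
  "GPBA k \<chi> \<longleftrightarrow> \<chi> \<in> carrier (Zpow 2 k) \<rightarrow> carrier (Zmod 2) \<and>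
    (\<forall>g \<in> carrier (Zpow 4 k) - ({..<k} \<rightarrow>\<^sub>E {0, 2}). AC (Zpow 4 k) (expansion k \<chi>) g = 0)"

definition GPBF :: "nat \<Rightarrow> ((nat \<Rightarrow> int) \<Rightarrow> int) \<Rightarrow> bool" where
  "GPBF k f \<longleftrightarrow> f \<in> carrier (Zpow 4 k) \<rightarrow> carrier (Zmod 2) \<and>
    (\<forall>x \<in> carrier (Zpow 4 k). \<bar>AC (Zpow 4 k) f x\<bar> \<in> {0, 4 ^ k})"

definition cocycles :: "('a, 'b) monoid_scheme \<Rightarrow> ('a \<Rightarrow> 'a \<Rightarrow> real) set" where
  "cocycles G = {\<psi>.
    (\<forall>a\<in>carrier G. \<forall>b\<in>carrier G. \<psi> a b \<in> {1, -1}) \<and>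
    (\<forall>a\<in>carrier G. \<forall>b\<in>carrier G. \<forall>c\<in>carrier G.
      \<psi> a b * \<psi> (a \<otimes>\<^bsub>G\<^esub> b) c = \<psi> a (b \<otimes>\<^bsub>G\<^esub> c) * \<psi> b c) \<and>
    \<psi> \<one>\<^bsub>G\<^esub> \<one>\<^bsub>G\<^esub> = 1}"

definition coboundary ::
  "('a, 'b) monoid_scheme \<Rightarrow> ('a \<Rightarrow> int) \<Rightarrow> 'a \<Rightarrow> 'a \<Rightarrow> real" where
  "coboundary G \<chi> x y = (-1) powi (\<chi> (x \<otimes>\<^bsub>G\<^esub> y) - \<chi> x - \<chi> y)"

definition mu_one :: "nat \<Rightarrow> (nat \<Rightarrow> int) \<Rightarrow> (nat \<Rightarrow> int) \<Rightarrow> real" where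
  "mu_one k x y = (\<Prod>i<k. (-1) powi ((x i + y i) div 2))"

text \<open>Square matrices are indexed by a finite set, as for \<open>[\<psi>(a, b)]\<close> with \<open>a, b \<in> G\<close>.\<close>

definition hadamard_matrix :: "'a set \<Rightarrow> ('a \<Rightarrow> 'a \<Rightarrow> real) \<Rightarrow> bool" where
  "hadamard_matrix S M \<longleftrightarrow> finite S \<and>
    (\<forall>a\<in>S. \<forall>b\<in>S. M a b \<in> {1, -1}) \<and>
    (\<forall>a\<in>S. \<forall>b\<in>S. (\<Sum>c\<in>S. M a c * M b c) = (if a = b then real (card S) else 0))"

definition orthogonal_cocycle ::
  "('a, 'b) monoid_scheme \<Rightarrow> ('a \<Rightarrow> 'a \<Rightarrow> real) \<Rightarrow> bool" where
  "orthogonal_cocycle G \<psi> \<longleftrightarrow> \<psi> \<in> cocycles G \<and> hadamard_matrix (carrier G) \<psi>"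

definition symmetric_cocycle ::
  "('a, 'b) monoid_scheme \<Rightarrow> ('a \<Rightarrow> 'a \<Rightarrow> real) \<Rightarrow> bool" where
  "symmetric_cocycle G \<psi> \<longleftrightarrow> \<psi> \<in> cocycles G \<and>
    (\<forall>a\<in>carrier G. \<forall>b\<in>carrier G. \<psi> a b = \<psi> b a)"

end

(* The zero map works. Its cocycle is mu_one (x, y) = (-1)^(x . y), whose matrix is Sylvester's
   Hadamard matrix. The signs of its expansion are the k-fold tensor power of the sequence
   + + - - on Z_4, so its autocorrelation at w is the product over the coordinates of the
   autocorrelations 4, 0, -4, 0 of that sequence. *)
theory Submission
  imports Defs
begin

lemma minus_one_powi: "(-1 :: real) powi n = (if even n then 1 else -1)"
  by (cases n rule: int_cases2) (auto simp: power_int_minus)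

lemma mult_Zpow: "x \<otimes>\<^bsub>Zpow t k\<^esub> y = (\<lambda>i\<in>{..<k}. (x i + y i) mod int t)"
  by (simp add: product_group_def integer_mod_group_def)

lemma one_Zpow: "\<one>\<^bsub>Zpow t k\<^esub> = (\<lambda>i\<in>{..<k}. 0)"
  by (simp add: product_group_def)

lemma minus_one_powi_sum_mod2_diff:
  "(-1 :: real) powi ((\<Sum>i\<in>A. f i) mod 2 - (\<Sum>i\<in>A. g i) mod 2) = (\<Prod>i\<in>A. (-1) powi (f i + g i))"
proof (induction A rule: infinite_finite_induct)
  case (insert a A)
  have "(-1 :: real) powi ((\<Sum>i\<in>insert a A. f i) mod 2 - (\<Sum>i\<in>insert a A. g i) mod 2)
      = (-1) powi (f a + g a) * (-1) powi ((\<Sum>i\<in>A. f i) mod 2 - (\<Sum>i\<in>A. g i) mod 2)"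
    using insert.hyps by (auto simp: minus_one_powi)
  with insert show ?case by simp
qed auto

lemma AC_expansion_zero:
  assumes "w \<in> carrier (Zpow 4 k)"
  shows "AC (Zpow 4 k) (expansion k (\<lambda>_. 0)) w
    = (\<Prod>i<k. if w i = 0 then 4 else if w i = 2 then -4 else 0)"
proof -
  have exponent: "expansion k (\<lambda>_. 0) g - expansion k (\<lambda>_. 0) (g \<otimes>\<^bsub>Zpow 4 k\<^esub> w)
      = (\<Sum>i<k. g i div 2) mod 2 - (\<Sum>i<k. ((g i + w i) mod 4) div 2) mod 2" for g
    by (simp add: expansion_def mult_Zpow)
  have "AC (Zpow 4 k) (expansion k (\<lambda>_. 0)) w
      = (\<Sum>g \<in> {..<k} \<rightarrow>\<^sub>E {0..<4}. \<Prod>i<k. (-1) powi (g i div 2 + ((g i + w i) mod 4) div 2))"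
    unfolding AC_def exponent minus_one_powi_sum_mod2_diff by (simp add: carrier_integer_mod_group)
  \<comment> \<open>The tuples range over a full product set, so by distributivity the sum of
    products is a product of sums.\<close>
  also have "\<dots> = (\<Prod>i<k. \<Sum>y\<in>{0..<4}. (-1) powi (y div 2 + ((y + w i) mod 4) div 2))"
    by (rule prod_sum_PiE [symmetric]) auto
  also have "\<dots> = (\<Prod>i<k. if w i = 0 then 4 else if w i = 2 then -4 else 0)"
  proof (rule prod.cong)
    fix i assume "i \<in> {..<k}"
    then have "w i \<in> {0..<4}" using assms by (auto simp: carrier_integer_mod_group PiE_iff)
    \<comment> \<open>Listing the residues makes each sum explicit: a shift by 2 flips every sign of
      + + - -, while a shift by 1 or 3 flips exactly two of the four.\<close>
    moreover have "{0..<4} = {0, 1, 2, 3 :: int}" by auto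
    ultimately show "(\<Sum>y\<in>{0..<4}. (-1 :: real) powi (y div 2 + ((y + w i) mod 4) div 2))
        = (if w i = 0 then 4 else if w i = 2 then -4 else 0)"
      by (auto simp: minus_one_powi)
  qed simp
  finally show ?thesis .
qed

lemma GPBA_zero: "GPBA k (\<lambda>_. 0)"
  unfolding GPBA_def
proof (intro conjI ballI)
  fix g assume g: "g \<in> carrier (Zpow 4 k) - ({..<k} \<rightarrow>\<^sub>E {0, 2})"
  \<comment> \<open>A coordinate equal to 1 or 3 contributes a zero factor to the product.\<close>
  then obtain i where "i < k" "g i \<noteq> 0" "g i \<noteq> 2"
    by (auto simp: carrier_integer_mod_group PiE_iff)
  with g show "AC (Zpow 4 k) (expansion k (\<lambda>_. 0)) g = 0"
    by (subst AC_expansion_zero) auto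
qed (simp add: carrier_integer_mod_group)

lemma GPBF_expansion_zero: "GPBF k (expansion k (\<lambda>_. 0))"
  unfolding GPBF_def
proof (intro conjI ballI)
  have "(\<Prod>i<n. \<bar>if w i = 0 then 4 else if w i = 2 then -4 else 0\<bar>) \<in> {0, 4 ^ n :: real}"
    for n and w :: "nat \<Rightarrow> int"
    by (induction n) auto
  then show "\<bar>AC (Zpow 4 k) (expansion k (\<lambda>_. 0)) x\<bar> \<in> {0, 4 ^ k}"
    if "x \<in> carrier (Zpow 4 k)" for x
    using that by (simp only: AC_expansion_zero abs_prod)
qed (auto simp: expansion_def carrier_integer_mod_group)

text \<open>In each coordinate the exponent is the carry of adding two bits. Adding three bits in
  either bracketing gives the same total carry, \<open>(a i + b i + c i) div 2\<close>, which is the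
  cocycle identity.\<close>

lemma mu_one_in_cocycles: "mu_one k \<in> cocycles (Zpow 2 k)"
proof -
  have cocycle: "mu_one k a b * mu_one k (a \<otimes>\<^bsub>Zpow 2 k\<^esub> b) c
      = mu_one k a (b \<otimes>\<^bsub>Zpow 2 k\<^esub> c) * mu_one k b c"
    if "a \<in> carrier (Zpow 2 k)" "b \<in> carrier (Zpow 2 k)" "c \<in> carrier (Zpow 2 k)" for a b c
    unfolding mu_one_def prod.distrib [symmetric] mult_Zpow
  proof (rule prod.cong)
    fix i assume i: "i \<in> {..<k}"
    then have "a i \<in> {0, 1}" "b i \<in> {0, 1}" "c i \<in> {0, 1}"
      using that by (force simp: carrier_integer_mod_group PiE_iff)+
    with i show "(-1 :: real) powi ((a i + b i) div 2)
        * (-1) powi (((\<lambda>i\<in>{..<k}. (a i + b i) mod int 2) i + c i) div 2)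
      = (-1) powi ((a i + (\<lambda>i\<in>{..<k}. (b i + c i) mod int 2) i) div 2)
        * (-1) powi ((b i + c i) div 2)"
      by auto
  qed simp
  have sign: "mu_one n a b \<in> {1, -1}" for n a b
    by (induction n) (auto simp: mu_one_def minus_one_powi)
  show ?thesis
    using cocycle sign by (simp add: cocycles_def one_Zpow mu_one_def)
qed

text \<open>For bits, \<open>(a i + y) div 2\<close> is the product of \<open>a i\<close> and
  \<open>y\<close>. The inner product of two rows thus factors into the sums
  \<open>1 + (-1) powi (a i + b i)\<close>, each 2 or 0 according to whether the bits agree.\<close>

lemma hadamard_matrix_mu_one: "hadamard_matrix (carrier (Zpow 2 k)) (mu_one k)"
  unfolding hadamard_matrix_def
proof (intro conjI ballI)
  show "finite (carrier (Zpow 2 k))"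
    by (simp add: carrier_integer_mod_group finite_PiE)
next
  fix a b assume ab: "a \<in> carrier (Zpow 2 k)" "b \<in> carrier (Zpow 2 k)"
  then show "mu_one k a b \<in> {1, -1}"
    using mu_one_in_cocycles by (auto simp: cocycles_def)
  have "(\<Sum>c\<in>carrier (Zpow 2 k). mu_one k a c * mu_one k b c)
      = (\<Prod>i<k. \<Sum>y\<in>{0..<2}. (-1) powi ((a i + y) div 2) * (-1) powi ((b i + y) div 2))"
    by (simp add: carrier_integer_mod_group mu_one_def prod.distrib [symmetric] prod_sum_PiE)
  also have "\<dots> = (\<Prod>i<k. if a i = b i then 2 else 0)"
  proof (rule prod.cong)
    fix i assume "i \<in> {..<k}"
    then have "a i \<in> {0, 1}" "b i \<in> {0, 1}"
      using ab by (force simp: carrier_integer_mod_group PiE_iff)+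
    moreover have "{0..<2} = {0, 1 :: int}" by auto
    ultimately show "(\<Sum>y\<in>{0..<2}. (-1 :: real) powi ((a i + y) div 2) * (-1) powi ((b i + y) div 2))
        = (if a i = b i then 2 else 0)"
      by auto
  qed simp
  also have "\<dots> = (if a = b then real (card (carrier (Zpow 2 k))) else 0)"
  proof (cases "a = b")
    case False
    moreover have "a \<in> {..<k} \<rightarrow>\<^sub>E {0..<2}" "b \<in> {..<k} \<rightarrow>\<^sub>E {0..<2}"
      using ab by (simp_all add: carrier_integer_mod_group)
    \<comment> \<open>Tuples in \<open>PiE\<close> are determined by their values on the index set,
      so distinct rows differ at some index below \<open>k\<close>, where the factor is 0.\<close>
    ultimately obtain i where "i < k" "a i \<noteq> b i"
      by (metis PiE_ext lessThan_iff)
    with False show ?thesis by auto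
  qed (simp add: carrier_integer_mod_group card_PiE)
  finally show "(\<Sum>c\<in>carrier (Zpow 2 k). mu_one k a c * mu_one k b c)
      = (if a = b then real (card (carrier (Zpow 2 k))) else 0)" .
qed

theorem mainTheorem2:
  fixes k :: nat
  assumes "k \<ge> 3"
  shows "\<exists>\<chi> \<in> carrier (Zpow 2 k) \<rightarrow> carrier (Zmod 2).
    (let \<psi> = (\<lambda>x y. mu_one k x y * coboundary (Zpow 2 k) \<chi> x y) in
      \<psi> \<in> cocycles (Zpow 2 k) \<and>
      symmetric_cocycle (Zpow 2 k) \<psi> \<and>
      orthogonal_cocycle (Zpow 2 k) \<psi>) \<and>
    GPBA k \<chi> \<and>
    GPBF k (expansion k \<chi>)"
proof (rule bexI [where x = "\<lambda>_. 0"])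
  \<comment> \<open>The coboundary of the zero map is constantly 1.\<close>
  have "(\<lambda>x y. mu_one k x y * coboundary (Zpow 2 k) (\<lambda>_. 0) x y) = mu_one k"
    by (simp add: coboundary_def)
  moreover have "mu_one k x y = mu_one k y x" for x y
    by (simp add: mu_one_def add.commute)
  ultimately show "(let \<psi> = (\<lambda>x y. mu_one k x y * coboundary (Zpow 2 k) (\<lambda>_. 0) x y) in
      \<psi> \<in> cocycles (Zpow 2 k) \<and>
      symmetric_cocycle (Zpow 2 k) \<psi> \<and>
      orthogonal_cocycle (Zpow 2 k) \<psi>) \<and>
    GPBA k (\<lambda>_. 0) \<and>
    GPBF k (expansion k (\<lambda>_. 0))"
    using mu_one_in_cocycles hadamard_matrix_mu_one GPBA_zero GPBF_expansion_zero
    by (simp add: symmetric_cocycle_def orthogonal_cocycle_def)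
qed (simp add: carrier_integer_mod_group)

end
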